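(* Let $(X,r)$ be a finite non-degenerate set-theoretic solution of the Yang--Baxter equation such that the structure skew brace $G(X,r)$ has property (S). Then $(X,r)$ is indecomposable if and only if $(X,r)$ is derived-indecomposable.
   Context: A set-theoretic solution of the Yang--Baxter equation is a pair $(X,r)$ with $X$ a (non-empty) set and $r:X\times X\to X\times X$ a bijection such that $(r\times\operatorname{id})(\operatorname{id}\times r)(r\times\operatorname{id})=(\operatorname{id}\times r)(r\times\operatorname{id})(\operatorname{id}\times r)$ on $X^3$. Write $r(x,y)=(\sigma_x(y),\tau_y(x))$; $(X,r)$ is non-degenerate if all maps $\sigma_x,\tau_y$ are bijective, and finite if $X$ is finite. $(X,r)$ is decomposable if there is a partition of $X$ into two disjoint non-empty subsets $X_1,X_2$ with $r(X_i\times X_i)\subseteq X_i\times X_i$ for $i=1,2$; otherwise it is indecomposable. The derived solution of a non-degenerate $(X,r)$ is the non-degenerate solution $(X,r')$ with $r'(x,y)=(y,\eta_y(x))$, $\eta_y(x)=\sigma_y\big(\tau_{\sigma_x^{-1}(y)}(x)\big)$. $(X,r)$ is derived-indecomposable if $(X,r')$ is indecomposable. A skew (left) brace is a triple $(B,+,\circ)$ where $(B,+)$ and $(B,\circ)$ are groups such that $a\circ(b+c)=a\circ b-a+a\circ c$ for all $a,b,c\in B$. The two identities coincide and are denoted $0$. Put $\lambda_a(b)=-a+a\circ b$, $a\ast b=-a+a\circ b-b$, and $r_B(a,b)=(\lambda_a(b),\lambda_a(b)^{-1}\circ a\circ b)$. For $x\in B$ let $\operatorname{Fix}^r(x)=\{b\in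 B: x\ast b=0\}$, $\operatorname{Fix}^l(x)=\{b\in B: b\ast x=0\}$, and let $C_x^+$, $C_x^\circ$ be the centralisers of $x$ in $(B,+)$ and $(B,\circ)$. $B$ has property (S) if for every $x\in B$ the indices $|(B,+):\operatorname{Fix}^r(x)\cap C_x^+|$ and $|(B,\circ):\operatorname{Fix}^l(x)\cap C_x^\circ|$ are finite. The structure skew brace $G(X,r)$ of a non-degenerate solution is the unique skew brace with multiplicative group $\langle X\mid xy=\sigma_x(y)\tau_y(x),\ x,y\in X\rangle$ such that $r_{G(X,r)}(\iota\times\iota)=(\iota\times\iota)r$, where $\iota:X\to G(X,r)$ is the canonical map; its additive group is $\langle X\mid x+\sigma_x(y)=\sigma_x(y)+\sigma_{\sigma_x(y)}(\tau_y(x)),\ x,y\in X\rangle$. *)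

theory Defs
  imports "HOL-Algebra.Coset" "HOL-Algebra.Ring"
begin

section \<open>Set-theoretic solutions\<close>

text \<open>\<open>r(x,y) = (\<sigma>\<^sub>x(y), \<tau>\<^sub>y(x))\<close>; only the values for \<open>x, y \<in> X\<close> matter.\<close>

definition sol_sigma :: "('a \<times> 'a \<Rightarrow> 'a \<times> 'a) \<Rightarrow> 'a \<Rightarrow> 'a \<Rightarrow> 'a"
  where "sol_sigma r x y = fst (r (x, y))"

definition sol_tau :: "('a \<times> 'a \<Rightarrow> 'a \<times> 'a) \<Rightarrow> 'a \<Rightarrow> 'a \<Rightarrow> 'a"
  where "sol_tau r y x = snd (r (x, y))"

definition times_id :: "('a \<times> 'a \<Rightarrow> 'a \<times> 'a) \<Rightarrow> 'a \<times> 'a \<times> 'a \<Rightarrow> 'a \<times> 'a \<times> 'a"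
  where "times_id r = (\<lambda>(x, y, z). case r (x, y) of (x', y') \<Rightarrow> (x', y', z))"

definition id_times :: "('a \<times> 'a \<Rightarrow> 'a \<times> 'a) \<Rightarrow> 'a \<times> 'a \<times> 'a \<Rightarrow> 'a \<times> 'a \<times> 'a"
  where "id_times r = map_prod id r"

locale ybe_solution =
  fixes X :: "'a set" and r :: "'a \<times> 'a \<Rightarrow> 'a \<times> 'a"
  assumes nonempty: "X \<noteq> {}"
    and bij: "bij_betw r (X \<times> X) (X \<times> X)"
    and ybe: "\<And>t. t \<in> X \<times> X \<times> X \<Longrightarrow>
      (times_id r \<circ> id_times r \<circ> times_id r) t = (id_times r \<circ> times_id r \<circ> id_times r) t"

locale nondegenerate_solution = ybe_solution +
  assumes sigma_bij: "\<And>x. x \<in> X \<Longrightarrow> bij_betw (sol_sigma r x) X X"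
    and tau_bij: "\<And>y. y \<in> X \<Longrightarrow> bij_betw (sol_tau r y) X X"

definition decomposable :: "'a set \<Rightarrow> ('a \<times> 'a \<Rightarrow> 'a \<times> 'a) \<Rightarrow> bool"
  where "decomposable X r \<longleftrightarrow>
    (\<exists>X1 X2. X1 \<noteq> {} \<and> X2 \<noteq> {} \<and> X1 \<inter> X2 = {} \<and> X1 \<union> X2 = X \<and>
      r ` (X1 \<times> X1) \<subseteq> X1 \<times> X1 \<and> r ` (X2 \<times> X2) \<subseteq> X2 \<times> X2)"

definition indecomposable :: "'a set \<Rightarrow> ('a \<times> 'a \<Rightarrow> 'a \<times> 'a) \<Rightarrow> bool"
  where "indecomposable X r \<longleftrightarrow> \<not> decomposable X r"

text \<open>The maps \<open>\<eta>\<^sub>y(x) = \<sigma>\<^sub>y(\<tau>\<^bsub>\<sigma>\<^sub>x\<^sup>-\<^sup>1(y)\<^esub>(x))\<close>, where \<open>\<sigma>\<^sub>x\<close> is inverted as a permutation of \<open>X\<close>.\<close>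

definition sol_eta :: "'a set \<Rightarrow> ('a \<times> 'a \<Rightarrow> 'a \<times> 'a) \<Rightarrow> 'a \<Rightarrow> 'a \<Rightarrow> 'a"
  where "sol_eta X r y x = sol_sigma r y (sol_tau r (inv_into X (sol_sigma r x) y) x)"

definition derived_solution :: "'a set \<Rightarrow> ('a \<times> 'a \<Rightarrow> 'a \<times> 'a) \<Rightarrow> 'a \<times> 'a \<Rightarrow> 'a \<times> 'a"
  where "derived_solution X r = (\<lambda>(x, y). (y, sol_eta X r y x))"

definition derived_indecomposable :: "'a set \<Rightarrow> ('a \<times> 'a \<Rightarrow> 'a \<times> 'a) \<Rightarrow> bool"
  where "derived_indecomposable X r \<longleftrightarrow> indecomposable X (derived_solution X r)"

section \<open>Skew braces\<close>

text \<open>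
  A skew brace \<open>(B, +, \<circ>)\<close> is carried by the \<open>ring\<close> record of HOL-Algebra, used only as a
  signature: \<open>\<oplus>\<close> is the (not necessarily commutative) addition and \<open>\<otimes>\<close> is the circle operation
  \<open>\<circ>\<close>.  Accordingly \<open>\<ominus>\<close> is the inverse in \<open>(B, +)\<close> and \<open>inv\<close> the inverse in \<open>(B, \<circ>)\<close>.
\<close>

locale skew_brace =
  fixes B (structure)
  assumes additive_group: "group (add_monoid B)"
    and multiplicative_group: "group B"
    and brace_law: "\<And>a b c. a \<in> carrier B \<Longrightarrow> b \<in> carrier B \<Longrightarrow> c \<in> carrier B \<Longrightarrow>
      a \<otimes> (b \<oplus> c) = ((a \<otimes> b) \<ominus> a) \<oplus> (a \<otimes> c)"

definition brace_lambda :: "('b, 'm) ring_scheme \<Rightarrow> 'b \<Rightarrow> 'b \<Rightarrow> 'b"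
  where "brace_lambda B a b = (\<ominus>\<^bsub>B\<^esub> a) \<oplus>\<^bsub>B\<^esub> (a \<otimes>\<^bsub>B\<^esub> b)"

definition brace_star :: "('b, 'm) ring_scheme \<Rightarrow> 'b \<Rightarrow> 'b \<Rightarrow> 'b"
  where "brace_star B a b = ((\<ominus>\<^bsub>B\<^esub> a) \<oplus>\<^bsub>B\<^esub> (a \<otimes>\<^bsub>B\<^esub> b)) \<ominus>\<^bsub>B\<^esub> b"

definition brace_r :: "('b, 'm) ring_scheme \<Rightarrow> 'b \<times> 'b \<Rightarrow> 'b \<times> 'b"
  where "brace_r B = (\<lambda>(a, b).
    (brace_lambda B a b, ((inv\<^bsub>B\<^esub> (brace_lambda B a b)) \<otimes>\<^bsub>B\<^esub> a) \<otimes>\<^bsub>B\<^esub> b))"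

definition Fix_r :: "('b, 'm) ring_scheme \<Rightarrow> 'b \<Rightarrow> 'b set"
  where "Fix_r B x = {b \<in> carrier B. brace_star B x b = \<zero>\<^bsub>B\<^esub>}"

definition Fix_l :: "('b, 'm) ring_scheme \<Rightarrow> 'b \<Rightarrow> 'b set"
  where "Fix_l B x = {b \<in> carrier B. brace_star B b x = \<zero>\<^bsub>B\<^esub>}"

definition centraliser :: "('b, 'm) monoid_scheme \<Rightarrow> 'b \<Rightarrow> 'b set"
  where "centraliser G x = {b \<in> carrier G. b \<otimes>\<^bsub>G\<^esub> x = x \<otimes>\<^bsub>G\<^esub> b}"

definition finite_index :: "('b, 'm) monoid_scheme \<Rightarrow> 'b set \<Rightarrow> bool"
  where "finite_index G H \<longleftrightarrow> finite (rcosets\<^bsub>G\<^esub> H)"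

definition property_S :: "('b, 'm) ring_scheme \<Rightarrow> bool"
  where "property_S B \<longleftrightarrow> (\<forall>x \<in> carrier B.
    finite_index (add_monoid B) (Fix_r B x \<inter> centraliser (add_monoid B) x) \<and>
    finite_index B (Fix_l B x \<inter> centraliser B x))"

section \<open>Groups given by generators and relations\<close>

text \<open>
  A word over \<open>X\<close> is a list of letters \<open>(x, True)\<close>, standing for \<open>x\<close>, and \<open>(x, False)\<close>, standing
  for the inverse of \<open>x\<close>.  A pair \<open>(l, m) \<in> R\<close> of words is the defining relation \<open>l = m\<close>.
\<close>

definition words :: "'a set \<Rightarrow> ('a \<times> bool) list set"
  where "words X = lists (X \<times> UNIV)"

inductive pres_eq ::
  "'a set \<Rightarrow> (('a \<times> bool) list \<times> ('a \<times> bool) list) set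
    \<Rightarrow> ('a \<times> bool) list \<Rightarrow> ('a \<times> bool) list \<Rightarrow> bool"
  for X R where
  refl: "pres_eq X R w w"
| sym: "pres_eq X R v w \<Longrightarrow> pres_eq X R w v"
| trans: "pres_eq X R u v \<Longrightarrow> pres_eq X R v w \<Longrightarrow> pres_eq X R u w"
| cancel: "x \<in> X \<Longrightarrow> pres_eq X R (u @ [(x, b), (x, \<not> b)] @ v) (u @ v)"
| rel: "(l, m) \<in> R \<Longrightarrow> pres_eq X R (u @ l @ v) (u @ m @ v)"

definition pres_class ::
  "'a set \<Rightarrow> (('a \<times> bool) list \<times> ('a \<times> bool) list) set
    \<Rightarrow> ('a \<times> bool) list \<Rightarrow> ('a \<times> bool) list set"
  where "pres_class X R w = {v \<in> words X. pres_eq X R w v}"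

definition presented_group ::
  "'a set \<Rightarrow> (('a \<times> bool) list \<times> ('a \<times> bool) list) set \<Rightarrow> ('a \<times> bool) list set monoid"
  where "presented_group X R =
    \<lparr> carrier = pres_class X R ` words X,
      mult = (\<lambda>U V. \<Union>u\<in>U. \<Union>v\<in>V. pres_class X R (u @ v)),
      one = pres_class X R [] \<rparr>"

lemma pres_eq_context:
  assumes "pres_eq X R u v" shows "pres_eq X R (p @ u @ q) (p @ v @ q)"
  using assms
proof induction
  case (refl w)
  show ?case by (rule pres_eq.refl)
next
  case (sym v w)
  show ?case by (rule pres_eq.sym[OF sym.IH])
next
  case (trans u v w)
  show ?case by (rule pres_eq.trans[OF trans.IH])
next
  case (cancel x u b v)
  then show ?case using pres_eq.cancel[of x X R "p @ u" b "v @ q"] by simp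
next
  case (rel l m u v)
  then show ?case using pres_eq.rel[of l m R X "p @ u" "v @ q"] by simp
qed

lemma pres_eq_append:
  assumes "pres_eq X R u u'" "pres_eq X R v v'" shows "pres_eq X R (u @ v) (u' @ v')"
proof (rule pres_eq.trans)
  show "pres_eq X R (u @ v) (u' @ v)" using pres_eq_context[OF assms(1), of "[]" v] by simp
  show "pres_eq X R (u' @ v) (u' @ v')" using pres_eq_context[OF assms(2), of u' "[]"] by simp
qed

lemma pres_class_eq_iff:
  assumes "v \<in> words X"
  shows "pres_class X R u = pres_class X R v \<longleftrightarrow> pres_eq X R u v"
proof
  assume "pres_class X R u = pres_class X R v"
  moreover have "v \<in> pres_class X R v" using assms by (simp add: pres_class_def pres_eq.refl)
  ultimately show "pres_eq X R u v" unfolding pres_class_def by blast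
next
  assume uv: "pres_eq X R u v"
  have "pres_eq X R u w \<longleftrightarrow> pres_eq X R v w" for w
    using pres_eq.trans[OF uv, of w] pres_eq.trans[OF pres_eq.sym[OF uv], of w] by blast
  then show "pres_class X R u = pres_class X R v" by (simp add: pres_class_def)
qed

lemma words_append [simp]: "u @ v \<in> words X \<longleftrightarrow> u \<in> words X \<and> v \<in> words X"
  by (auto simp: words_def)

lemma presented_group_mult:
  assumes "u \<in> words X" "v \<in> words X"
  shows "pres_class X R u \<otimes>\<^bsub>presented_group X R\<^esub> pres_class X R v = pres_class X R (u @ v)"
proof -
  have "pres_class X R (u' @ v') = pres_class X R (u @ v)"
    if "u' \<in> pres_class X R u" "v' \<in> pres_class X R v" for u' v'
    using that assms pres_eq.sym[OF pres_eq_append[of X R u u' v v']]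
    by (simp add: pres_class_eq_iff pres_class_def[of X R u] pres_class_def[of X R v])
  moreover have "u \<in> pres_class X R u" "v \<in> pres_class X R v"
    using assms by (auto simp: pres_class_def intro: pres_eq.refl)
  ultimately have "(\<Union>u'\<in>pres_class X R u. \<Union>v'\<in>pres_class X R v. pres_class X R (u' @ v')) =
      pres_class X R (u @ v)"
    by blast
  then show ?thesis by (simp add: presented_group_def)
qed

definition word_inv :: "('a \<times> bool) list \<Rightarrow> ('a \<times> bool) list"
  where "word_inv w = rev (map (\<lambda>(x, b). (x, \<not> b)) w)"

lemma word_inv_words: "w \<in> words X \<Longrightarrow> word_inv w \<in> words X"
  by (auto simp: word_inv_def words_def)

lemma word_inv_left: "w \<in> words X \<Longrightarrow> pres_eq X R (word_inv w @ w) []"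
proof (induction w)
  case Nil
  then show ?case by (simp add: word_inv_def pres_eq.refl)
next
  case (Cons a w)
  obtain x b where a: "a = (x, b)" by (cases a)
  have x: "x \<in> X" and w: "w \<in> words X" using Cons.prems a by (auto simp: words_def)
  have "pres_eq X R (word_inv w @ [(x, \<not> b), (x, \<not> \<not> b)] @ w) (word_inv w @ w)"
    by (rule pres_eq.cancel[OF x])
  then have "pres_eq X R (word_inv (a # w) @ a # w) (word_inv w @ w)"
    by (simp add: a word_inv_def)
  then show ?case using Cons.IH[OF w] by (rule pres_eq.trans)
qed

lemma group_presented_group: "group (presented_group X R)"
proof (rule groupI)
  let ?G = "presented_group X R"
  have nil: "[] \<in> words X" by (simp add: words_def)
  have car: "carrier ?G = pres_class X R ` words X" and one: "\<one>\<^bsub>?G\<^esub> = pres_class X R []"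
    by (simp_all add: presented_group_def)
  show "\<one>\<^bsub>?G\<^esub> \<in> carrier ?G" using nil car one by blast
  fix a assume a: "a \<in> carrier ?G"
  then obtain u where u: "u \<in> words X" "a = pres_class X R u" using car by blast
  show "\<one>\<^bsub>?G\<^esub> \<otimes>\<^bsub>?G\<^esub> a = a" using u nil by (simp add: one presented_group_mult)
  have "pres_class X R (word_inv u) \<otimes>\<^bsub>?G\<^esub> a = \<one>\<^bsub>?G\<^esub>"
    using u nil by (simp add: one presented_group_mult word_inv_words pres_class_eq_iff word_inv_left)
  then show "\<exists>y\<in>carrier ?G. y \<otimes>\<^bsub>?G\<^esub> a = \<one>\<^bsub>?G\<^esub>" using u word_inv_words car by blast
  fix b assume b: "b \<in> carrier ?G"
  then obtain v where v: "v \<in> words X" "b = pres_class X R v" using car by blast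
  show "a \<otimes>\<^bsub>?G\<^esub> b \<in> carrier ?G" using u v by (simp add: car presented_group_mult)
  fix c assume "c \<in> carrier ?G"
  then obtain w where w: "w \<in> words X" "c = pres_class X R w" using car by blast
  show "a \<otimes>\<^bsub>?G\<^esub> b \<otimes>\<^bsub>?G\<^esub> c = a \<otimes>\<^bsub>?G\<^esub> (b \<otimes>\<^bsub>?G\<^esub> c)"
    using u v w by (simp add: presented_group_mult)
qed

section \<open>The structure skew brace of a solution\<close>

definition structure_relations ::
  "'a set \<Rightarrow> ('a \<times> 'a \<Rightarrow> 'a \<times> 'a) \<Rightarrow> (('a \<times> bool) list \<times> ('a \<times> bool) list) set"
  where "structure_relations X r =
    {([(x, True), (y, True)], [(sol_sigma r x y, True), (sol_tau r y x, True)]) | x y.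
      x \<in> X \<and> y \<in> X}"

definition structure_group ::
  "'a set \<Rightarrow> ('a \<times> 'a \<Rightarrow> 'a \<times> 'a) \<Rightarrow> ('a \<times> bool) list set monoid"
  where "structure_group X r = presented_group X (structure_relations X r)"

definition structure_iota :: "'a set \<Rightarrow> ('a \<times> 'a \<Rightarrow> 'a \<times> 'a) \<Rightarrow> 'a \<Rightarrow> ('a \<times> bool) list set"
  where "structure_iota X r x = pres_class X (structure_relations X r) [(x, True)]"

text \<open>
  \<open>B = G(X,r)\<close>: a skew brace whose multiplicative group is the structure group and whose associated
  solution satisfies \<open>r\<^sub>B(\<iota> \<times> \<iota>) = (\<iota> \<times> \<iota>)r\<close> on \<open>X \<times> X\<close>.  By the theorem of Lu--Yan--Zhu and
  Guarnieri--Vendramin such a \<open>B\<close> exists for every non-degenerate solution and its addition on the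
  carrier is uniquely determined, so this predicate characterises \<open>G(X,r)\<close>.
\<close>

definition is_structure_skew_brace ::
  "'a set \<Rightarrow> ('a \<times> 'a \<Rightarrow> 'a \<times> 'a) \<Rightarrow> ('a \<times> bool) list set ring \<Rightarrow> bool"
  where "is_structure_skew_brace X r B \<longleftrightarrow>
    skew_brace B \<and>
    monoid.truncate B = structure_group X r \<and>
    (\<forall>x\<in>X. \<forall>y\<in>X.
      brace_r B (map_prod (structure_iota X r) (structure_iota X r) (x, y)) =
      map_prod (structure_iota X r) (structure_iota X r) (r (x, y)))"

end

theory Submission
  imports Defs
begin

text \<open>
  A decomposition of \<open>(X,r)\<close> is always a decomposition of the derived solution: since \<open>X\<close> is finite,
  its parts are invariant under all \<open>\<sigma>\<^sub>x\<close> and \<open>\<tau>\<^sub>y\<close>, hence under all \<open>\<eta>\<^sub>y\<close>.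

  Conversely, the parts of a decomposition of the derived solution are invariant under all \<open>\<eta>\<^sub>y\<close>, and
  property (S) makes them invariant under all \<open>\<sigma>\<^sub>x\<close> as well, for the following reason.  The additive
  group of \<open>G(X,r)\<close> modulo commutators is the free abelian group on the orbits of the \<open>\<eta>\<^sub>y\<close>, and
  \<open>\<lambda>\<^bsub>\<iota>(x)\<^esub>\<close> permutes its basis as \<open>\<sigma>\<^sub>x\<close> permutes the orbits.  By (S), \<open>\<lambda>\<^bsub>\<iota>(x)\<^esub>\<close> fixes a subgroup of
  finite index, hence a positive multiple of each basis element, so the permutation is trivial.
  Since \<open>\<eta>\<close> is built from \<open>\<sigma>\<close> and \<open>\<tau>\<close>, the parts are then invariant under all \<open>\<tau>\<^sub>y\<close>, and decompose
  \<open>(X,r)\<close>.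

  The argument is carried out without computing the additive group.  An integer function \<open>h\<close> on \<open>X\<close>
  that is constant on the \<open>\<eta>\<close>-orbits (such as the indicator function of a part) should define an
  additive functional on \<open>G(X,r)\<close> with value \<open>h(x)\<close> at \<open>\<iota>(x)\<close>.  Read through
  \<open>a \<circ> b = a + \<lambda>\<^sub>a(b)\<close>, such a functional becomes an explicit weight on words in the generators of the
  multiplicative group.  The weight respects the defining relations (\<open>weight_pres_eq\<close>), and the
  multiple \<open>n \<iota>(y)\<close> is the class of a positive word of weight \<open>n h(y)\<close> (\<open>multiple_iota_word\<close>).  Now (S)
  gives \<open>n \<iota>(\<sigma>\<^sub>x(y)) = \<lambda>\<^bsub>\<iota>(x)\<^esub>(n \<iota>(y)) = n \<iota>(y)\<close> for some \<open>n > 0\<close>, whence \<open>h(\<sigma>\<^sub>x(y)) = h(y)\<close>.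
\<close>

section \<open>Decompositions and invariant functions\<close>

lemma bij_betw_preserves_subset:
  assumes "finite X" "bij_betw f X X" "Y \<subseteq> X" "f ` Y \<subseteq> Y" "z \<in> X"
  shows "f z \<in> Y \<longleftrightarrow> z \<in> Y"
proof -
  have inj: "inj_on f X" using assms(2) by (simp add: bij_betw_def)
  have "f ` Y = Y"
    by (rule endo_inj_surj[OF finite_subset[OF assms(3,1)] assms(4) inj_on_subset[OF inj assms(3)]])
  then show ?thesis using inj_on_image_mem_iff[OF inj assms(5,3)] by simp
qed

text \<open>
  The condition \<open>r(X\<^sub>i \<times> X\<^sub>i) \<subseteq> X\<^sub>i \<times> X\<^sub>i\<close> only says that
  \<open>\<sigma>\<^sub>x\<close> maps the part containing \<open>x\<close> into itself; on a finite set this part is then permuted, and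
  so is its complement.  Hence either alternative below makes both parts invariant.
\<close>

lemma bij_betw_preserves_parts:
  assumes "finite X" "bij_betw f X X" "X1 \<union> X2 = X" "X1 \<inter> X2 = {}"
    and "f ` X1 \<subseteq> X1 \<or> f ` X2 \<subseteq> X2" "z \<in> X"
  shows "f z \<in> X1 \<longleftrightarrow> z \<in> X1"
  using assms(5)
proof
  assume "f ` X1 \<subseteq> X1"
  then show ?thesis using assms by (intro bij_betw_preserves_subset) auto
next
  assume "f ` X2 \<subseteq> X2"
  then have "f z \<in> X2 \<longleftrightarrow> z \<in> X2" using assms by (intro bij_betw_preserves_subset) auto
  moreover have "f z \<in> X" using assms(2,6) bij_betwE by blast
  ultimately show ?thesis using assms(3,4,6) by blast
qed

definition eta_invariant :: "'a set \<Rightarrow> ('a \<times> 'a \<Rightarrow> 'a \<times> 'a) \<Rightarrow> ('a \<Rightarrow> int) \<Rightarrow> bool"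
  where "eta_invariant X r h \<longleftrightarrow> (\<forall>x\<in>X. \<forall>y\<in>X. h (sol_eta X r y x) = h x)"

context nondegenerate_solution
begin

lemma r_eq: "r (x, y) = (sol_sigma r x y, sol_tau r y x)"
  by (simp add: sol_sigma_def sol_tau_def)

lemma sigma_closed: "x \<in> X \<Longrightarrow> y \<in> X \<Longrightarrow> sol_sigma r x y \<in> X"
  using sigma_bij bij_betwE by blast

lemma tau_closed: "x \<in> X \<Longrightarrow> y \<in> X \<Longrightarrow> sol_tau r y x \<in> X"
  using tau_bij bij_betwE by blast

lemma sigma_surj: "x \<in> X \<Longrightarrow> y \<in> X \<Longrightarrow> \<exists>z\<in>X. y = sol_sigma r x z"
  using sigma_bij[of x] by (auto simp: bij_betw_def)

lemma ybe_sigma: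
  assumes "x \<in> X" "y \<in> X" "z \<in> X"
  shows "sol_sigma r x (sol_sigma r y z) = sol_sigma r (sol_sigma r x y) (sol_sigma r (sol_tau r y x) z)"
    and "sol_tau r (sol_sigma r (sol_tau r y x) z) (sol_sigma r x y) =
      sol_sigma r (sol_tau r (sol_sigma r y z) x) (sol_tau r z y)"
  using ybe[of "(x, y, z)"] assms by (simp_all add: times_id_def id_times_def r_eq)

lemma eta_sigma:
  assumes "x \<in> X" "y \<in> X"
  shows "sol_eta X r (sol_sigma r x y) x = sol_sigma r (sol_sigma r x y) (sol_tau r y x)"
  using assms sigma_bij[of x] by (simp add: sol_eta_def bij_betw_def inv_into_f_f)

lemma eta_closed: "x \<in> X \<Longrightarrow> y \<in> X \<Longrightarrow> sol_eta X r y x \<in> X"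
  using sigma_surj[of x y] by (auto simp: eta_sigma sigma_closed tau_closed)

text \<open>
  Each \<open>\<sigma>\<^sub>x\<close> is an automorphism of the operation \<open>(z, y) \<mapsto> \<eta>\<^sub>z(y)\<close>: with \<open>z = \<sigma>\<^sub>y(u)\<close> this is the
  first component of the braid relation at \<open>(x, y, u)\<close> combined with the middle one.
\<close>

lemma sigma_eta:
  assumes "x \<in> X" "y \<in> X" "z \<in> X"
  shows "sol_sigma r x (sol_eta X r z y) = sol_eta X r (sol_sigma r x z) (sol_sigma r x y)"
proof -
  obtain u where u: "u \<in> X" "z = sol_sigma r y u" using assms sigma_surj by blast
  have "sol_sigma r x (sol_eta X r z y) =
      sol_sigma r x (sol_sigma r (sol_sigma r y u) (sol_tau r u y))"
    using u assms by (simp add: eta_sigma)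
  also have "\<dots> = sol_sigma r (sol_sigma r x (sol_sigma r y u))
      (sol_sigma r (sol_tau r (sol_sigma r y u) x) (sol_tau r u y))"
    using u assms by (intro ybe_sigma) (auto simp: sigma_closed tau_closed)
  also have "\<dots> = sol_sigma r (sol_sigma r x (sol_sigma r y u))
      (sol_tau r (sol_sigma r (sol_tau r y x) u) (sol_sigma r x y))"
    using u assms by (simp add: ybe_sigma(2))
  also have "\<dots> = sol_eta X r (sol_sigma r x z) (sol_sigma r x y)"
    using u assms ybe_sigma(1)[of x y u]
    by (simp add: eta_sigma sigma_closed tau_closed)
  finally show ?thesis .
qed

text \<open>
  Injectivity comes from that of \<open>r\<close>: the value \<open>\<eta>\<^sub>y(x)\<close> determines \<open>r(x, \<sigma>\<^sub>x\<^sup>-\<^sup>1(y))\<close>, whose components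
  are \<open>y\<close> and \<open>\<sigma>\<^sub>y\<^sup>-\<^sup>1(\<eta>\<^sub>y(x))\<close>.
\<close>

lemma eta_bij:
  assumes "finite X" "y \<in> X"
  shows "bij_betw (sol_eta X r y) X X"
proof -
  have inv: "inv_into X (sol_sigma r x) y \<in> X" "sol_sigma r x (inv_into X (sol_sigma r x) y) = y"
    if "x \<in> X" for x
    using bij_betw_inv_into_right[OF sigma_bij[OF that] assms(2)]
      bij_betwE[OF bij_betw_inv_into[OF sigma_bij[OF that]]] assms(2) by simp_all
  have closed: "sol_eta X r y ` X \<subseteq> X" using assms(2) eta_closed by blast
  have "inj_on (sol_eta X r y) X"
  proof (rule inj_onI)
    fix x x' assume x: "x \<in> X" "x' \<in> X" and eq: "sol_eta X r y x = sol_eta X r y x'"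
    let ?z = "inv_into X (sol_sigma r x) y" and ?z' = "inv_into X (sol_sigma r x') y"
    have "sol_tau r ?z x = sol_tau r ?z' x'"
      by (rule inj_onD[OF bij_betw_imp_inj_on[OF sigma_bij[OF assms(2)]] eq[unfolded sol_eta_def]])
         (simp_all add: tau_closed inv x)
    then have "r (x, ?z) = r (x', ?z')" using inv x by (simp add: r_eq)
    then have "(x, ?z) = (x', ?z')"
      by (rule inj_onD[OF bij_betw_imp_inj_on[OF bij]]) (simp_all add: inv x)
    then show "x = x'" by simp
  qed
  then show ?thesis using closed assms(1) by (simp add: bij_betw_def endo_inj_surj)
qed

lemma decomposable_imp_derived_decomposable:
  assumes "finite X" "decomposable X r"
  shows "decomposable X (derived_solution X r)"
proof -
  obtain X1 X2 where X: "X1 \<noteq> {}" "X2 \<noteq> {}" "X1 \<inter> X2 = {}" "X1 \<union> X2 = X"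
      and r1: "r ` (X1 \<times> X1) \<subseteq> X1 \<times> X1" and r2: "r ` (X2 \<times> X2) \<subseteq> X2 \<times> X2"
    using assms(2) unfolding decomposable_def by (elim exE conjE) (rule that)
  have s: "sol_sigma r x y \<in> X1 \<longleftrightarrow> y \<in> X1" if "x \<in> X" "y \<in> X" for x y
  proof (rule bij_betw_preserves_parts[OF assms(1) sigma_bij[OF that(1)] X(4,3) _ that(2)])
    show "sol_sigma r x ` X1 \<subseteq> X1 \<or> sol_sigma r x ` X2 \<subseteq> X2"
      using r1 r2 that(1) X(4) by (auto simp: r_eq image_subset_iff)
  qed
  have t: "sol_tau r y x \<in> X1 \<longleftrightarrow> x \<in> X1" if "x \<in> X" "y \<in> X" for x y
  proof (rule bij_betw_preserves_parts[OF assms(1) tau_bij[OF that(2)] X(4,3) _ that(1)])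
    show "sol_tau r y ` X1 \<subseteq> X1 \<or> sol_tau r y ` X2 \<subseteq> X2"
      using r1 r2 that(2) X(4) by (auto simp: r_eq image_subset_iff)
  qed
  have e: "sol_eta X r y x \<in> X \<and> (sol_eta X r y x \<in> X1 \<longleftrightarrow> x \<in> X1)"
    if "x \<in> X" "y \<in> X" for x y
  proof -
    obtain z where "z \<in> X" "y = sol_sigma r x z" using \<open>x \<in> X\<close> \<open>y \<in> X\<close> sigma_surj by blast
    then show ?thesis using \<open>x \<in> X\<close> by (simp add: eta_sigma s t sigma_closed tau_closed)
  qed
  have "derived_solution X r ` (X1 \<times> X1) \<subseteq> X1 \<times> X1"
      "derived_solution X r ` (X2 \<times> X2) \<subseteq> X2 \<times> X2"
    using e X(3,4) by (auto simp: derived_solution_def)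
  then show ?thesis using X unfolding decomposable_def by (intro exI[of _ X1] exI[of _ X2]) simp
qed

lemma eta_invariant_derived_part:
  assumes "finite X" "X1 \<inter> X2 = {}" "X1 \<union> X2 = X"
    and "derived_solution X r ` (X1 \<times> X1) \<subseteq> X1 \<times> X1"
    and "derived_solution X r ` (X2 \<times> X2) \<subseteq> X2 \<times> X2"
  shows "eta_invariant X r (\<lambda>x. if x \<in> X1 then 1 else 0)"
proof -
  have "sol_eta X r y x \<in> X1 \<longleftrightarrow> x \<in> X1" if "x \<in> X" "y \<in> X" for x y
  proof (rule bij_betw_preserves_parts[OF assms(1) eta_bij[OF assms(1) that(2)] assms(3,2) _ that(1)])
    show "sol_eta X r y ` X1 \<subseteq> X1 \<or> sol_eta X r y ` X2 \<subseteq> X2"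
      using assms(3-5) that(2) by (auto simp: derived_solution_def image_subset_iff)
  qed
  then show ?thesis by (simp add: eta_invariant_def)
qed

text \<open>
  From \<open>\<eta>\<^bsub>\<sigma>\<^sub>x(y)\<^esub>(x) = \<sigma>\<^bsub>\<sigma>\<^sub>x(y)\<^esub>(\<tau>\<^sub>y(x))\<close>, invariance under \<open>\<eta>\<close> and \<open>\<sigma>\<close> passes to \<open>\<tau>\<close>.
\<close>

lemma decomposable_if_sigma_invariant:
  assumes X: "X1 \<noteq> {}" "X2 \<noteq> {}" "X1 \<inter> X2 = {}" "X1 \<union> X2 = X"
    and e: "\<And>x y. x \<in> X \<Longrightarrow> y \<in> X \<Longrightarrow> sol_eta X r y x \<in> X1 \<longleftrightarrow> x \<in> X1"
    and s: "\<And>x y. x \<in> X \<Longrightarrow> y \<in> X \<Longrightarrow> sol_sigma r x y \<in> X1 \<longleftrightarrow> y \<in> X1"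
  shows "decomposable X r"
proof -
  have t: "sol_tau r y x \<in> X1 \<longleftrightarrow> x \<in> X1" if "x \<in> X" "y \<in> X" for x y
    using e[of x "sol_sigma r x y"] s[of "sol_sigma r x y" "sol_tau r y x"] that
    by (simp add: eta_sigma sigma_closed tau_closed)
  have parts: "r ` (Xi \<times> Xi) \<subseteq> Xi \<times> Xi" if "Xi = X1 \<or> Xi = X2" for Xi
  proof (clarsimp simp: r_eq)
    fix x y assume "x \<in> Xi" "y \<in> Xi"
    moreover from this have "x \<in> X" "y \<in> X" using that X by auto
    ultimately show "sol_sigma r x y \<in> Xi \<and> sol_tau r y x \<in> Xi"
      using that X s[of x y] t[of x y] sigma_closed[of x y] tau_closed[of x y] by auto
  qed
  show ?thesis using X parts[of X1] parts[of X2] unfolding decomposable_def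
    by (intro exI[of _ X1] exI[of _ X2]) simp
qed

end

section \<open>The weight of a word\<close>

text \<open>
  \<open>\<sigma>\<^sub>x\<close> extended by the identity to a permutation of the whole type, and the identity for \<open>x \<notin> X\<close>.
  Thus inverse letters act by honest inverses, and words may contain letters outside \<open>X\<close>, as those
  related by \<^const>\<open>pres_eq\<close> may.
\<close>

definition sigma_perm :: "'a set \<Rightarrow> ('a \<times> 'a \<Rightarrow> 'a \<times> 'a) \<Rightarrow> 'a \<Rightarrow> 'a \<Rightarrow> 'a"
  where "sigma_perm X r x z = (if x \<in> X \<and> z \<in> X then sol_sigma r x z else z)"

definition letter_perm :: "'a set \<Rightarrow> ('a \<times> 'a \<Rightarrow> 'a \<times> 'a) \<Rightarrow> 'a \<times> bool \<Rightarrow> 'a \<Rightarrow> 'a"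
  where "letter_perm X r a =
    (if snd a then sigma_perm X r (fst a) else inv_into UNIV (sigma_perm X r (fst a)))"

fun word_perm :: "'a set \<Rightarrow> ('a \<times> 'a \<Rightarrow> 'a \<times> 'a) \<Rightarrow> ('a \<times> bool) list \<Rightarrow> 'a \<Rightarrow> 'a"
  where
    "word_perm X r [] = id"
  | "word_perm X r (a # w) = letter_perm X r a \<circ> word_perm X r w"

text \<open>
  The positive letter \<open>x\<close> in a word \<open>u x v\<close> contributes \<open>h(u\<cdot>x)\<close>, where \<open>u\<close> acts through the \<open>\<sigma>\<close>s;
  this matches the summand \<open>\<lambda>\<^sub>u(x)\<close> of the expansion of a product by \<open>a \<circ> b = a + \<lambda>\<^sub>a(b)\<close>.  An inverse
  letter contributes \<open>- h(u\<cdot>x\<^sup>-\<^sup>1\<cdot>x)\<close>, as \<open>x\<^sup>-\<^sup>1 = - \<lambda>\<^bsub>x\<^sup>-\<^sup>1\<^esub>(x)\<close>.  In the recursion, the action of the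
  letters already read is accumulated in the function \<open>h\<close>.
\<close>

fun weight :: "'a set \<Rightarrow> ('a \<times> 'a \<Rightarrow> 'a \<times> 'a) \<Rightarrow> ('a \<Rightarrow> int) \<Rightarrow> ('a \<times> bool) list \<Rightarrow> int"
  where
    "weight X r h [] = 0"
  | "weight X r h ((x, b) # w) =
      (if b then h x else - h (letter_perm X r (x, b) x)) + weight X r (h \<circ> letter_perm X r (x, b)) w"

context nondegenerate_solution
begin

lemma sigma_perm_bij: "bij (sigma_perm X r x)"
proof (cases "x \<in> X")
  case True
  have "bij_betw (sigma_perm X r x) X X"
    using sigma_bij[OF True] by (rule bij_betw_cong[THEN iffD1, rotated]) (simp add: sigma_perm_def True)
  moreover have "bij_betw (sigma_perm X r x) (- X) (- X)"
    by (rule bij_betw_cong[THEN iffD1, OF _ bij_betw_id]) (simp add: sigma_perm_def)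
  ultimately have "bij_betw (sigma_perm X r x) (X \<union> - X) (X \<union> - X)"
    by (rule bij_betw_combine) simp
  then show ?thesis by (simp only: Compl_partition)
next
  case False
  then have "sigma_perm X r x = id" by (auto simp: sigma_perm_def)
  then show ?thesis by simp
qed

lemma letter_perm_bij: "bij (letter_perm X r a)"
  by (simp add: letter_perm_def sigma_perm_bij bij_imp_bij_inv)

lemma word_perm_bij: "bij (word_perm X r w)"
proof (induction w)
  case (Cons a w)
  then show ?case using letter_perm_bij[of a] by (simp only: word_perm.simps bij_comp)
qed (simp only: word_perm.simps bij_id)

lemma sigma_perm_in_iff: "sigma_perm X r x z \<in> X \<longleftrightarrow> z \<in> X"
  by (simp add: sigma_perm_def sigma_closed)

lemma letter_perm_in_iff: "letter_perm X r a z \<in> X \<longleftrightarrow> z \<in> X"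
proof (cases "snd a")
  case False
  then show ?thesis
    using sigma_perm_in_iff[of "fst a" "inv_into UNIV (sigma_perm X r (fst a)) z"] sigma_perm_bij[of "fst a"]
    by (simp add: letter_perm_def bij_is_surj surj_f_inv_f)
qed (simp add: letter_perm_def sigma_perm_in_iff)

lemma word_perm_in_iff: "word_perm X r w z \<in> X \<longleftrightarrow> z \<in> X"
  by (induction w) (simp_all add: letter_perm_in_iff)

lemma letter_perm_cancel: "letter_perm X r (x, b) (letter_perm X r (x, \<not> b) z) = z"
  using sigma_perm_bij[of x]
  by (cases b) (simp_all add: letter_perm_def bij_is_surj surj_f_inv_f bij_is_inj inv_f_f)

lemma eta_invariant_sigma_perm:
  assumes "eta_invariant X r h" shows "eta_invariant X r (h \<circ> sigma_perm X r x)"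
  using assms by (auto simp: eta_invariant_def sigma_perm_def eta_closed sigma_eta sigma_closed)

lemma eta_invariant_inv_sigma_perm:
  assumes "eta_invariant X r h" shows "eta_invariant X r (h \<circ> inv_into UNIV (sigma_perm X r x))"
proof (cases "x \<in> X")
  case True
  have inv: "inv_into UNIV (sigma_perm X r x) (sol_sigma r x z) = z" if "z \<in> X" for z
    using that True inv_f_f[OF bij_is_inj[OF sigma_perm_bij], of x z] by (simp add: sigma_perm_def)
  have "h (inv_into UNIV (sigma_perm X r x) (sol_eta X r y z)) = h (inv_into UNIV (sigma_perm X r x) z)"
    if y: "y \<in> X" and z: "z \<in> X" for y z
  proof -
    obtain y' z' where y': "y' \<in> X" "y = sol_sigma r x y'" and z': "z' \<in> X" "z = sol_sigma r x z'"
      using sigma_surj[OF True y] sigma_surj[OF True z] by blast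
    then have "sol_eta X r y z = sol_sigma r x (sol_eta X r y' z')"
      using sigma_eta[OF True] by simp
    then show ?thesis using y' z' assms by (simp add: inv eta_closed eta_invariant_def)
  qed
  then show ?thesis by (simp add: eta_invariant_def)
next
  case False
  then have "sigma_perm X r x = id" by (auto simp: sigma_perm_def)
  then show ?thesis using assms by simp
qed

lemma eta_invariant_word_perm:
  "eta_invariant X r h \<Longrightarrow> eta_invariant X r (h \<circ> word_perm X r w)"
proof (induction w arbitrary: h)
  case (Cons a w)
  have "eta_invariant X r (h \<circ> letter_perm X r a)"
    using Cons.prems by (simp add: letter_perm_def eta_invariant_sigma_perm eta_invariant_inv_sigma_perm)
  then show ?case using Cons.IH by (simp only: word_perm.simps comp_assoc[symmetric])
qed simp

lemma weight_append: "weight X r h (u @ v) = weight X r h u + weight X r (h \<circ> word_perm X r u) v"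
proof (induction u arbitrary: h)
  case (Cons a u)
  then show ?case by (cases a) (simp add: o_def)
qed simp

lemma weight_cancel: "weight X r h ((x, b) # (x, \<not> b) # w) = weight X r h w"
proof -
  have "h \<circ> letter_perm X r (x, b) \<circ> letter_perm X r (x, \<not> b) = h"
    by (rule ext) (simp add: letter_perm_cancel)
  then show ?thesis using letter_perm_cancel[of x b x] by (cases b) simp_all
qed

text \<open>
  Both sides of the relation \<open>xy = \<sigma>\<^sub>x(y) \<tau>\<^sub>y(x)\<close> act alike on \<open>X\<close>.  Their weights are
  \<open>h(x) + h(\<sigma>\<^sub>x(y))\<close> and \<open>h(\<sigma>\<^sub>x(y)) + h(\<sigma>\<^bsub>\<sigma>\<^sub>x(y)\<^esub>(\<tau>\<^sub>y(x)))\<close>, which agree because the argument of the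
  last term is \<open>\<eta>\<^bsub>\<sigma>\<^sub>x(y)\<^esub>(x)\<close>.
\<close>

lemma weight_relation:
  assumes h: "eta_invariant X r h" and x: "x \<in> X" "y \<in> X"
  shows "weight X r h ([(x, True), (y, True)] @ w) =
    weight X r h ([(sol_sigma r x y, True), (sol_tau r y x, True)] @ w)"
proof -
  let ?s = "sol_sigma r x y" and ?t = "sol_tau r y x"
  have st: "?s \<in> X" "?t \<in> X" using x by (simp_all add: sigma_closed tau_closed)
  have perm: "sigma_perm X r x \<circ> sigma_perm X r y = sigma_perm X r ?s \<circ> sigma_perm X r ?t"
    using x st by (auto simp: sigma_perm_def sigma_closed ybe_sigma(1))
  have "h (sigma_perm X r ?s ?t) = h x"
    using h x st by (simp add: eta_invariant_def sigma_perm_def eta_sigma[symmetric])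
  then show ?thesis
    using x st perm by (simp add: letter_perm_def comp_assoc) (simp add: sigma_perm_def)
qed

text \<open>
  A cancellation or relation is applied behind a prefix \<open>u\<close>, so it is tested on \<open>h\<close> composed with the
  action of \<open>u\<close>; this is again \<open>\<eta>\<close>-invariant because every \<open>\<sigma>\<^sub>x\<close> permutes the \<open>\<eta>\<close>-orbits.
\<close>

lemma weight_pres_eq:
  assumes "pres_eq X (structure_relations X r) u v" "eta_invariant X r h"
  shows "weight X r h u = weight X r h v"
  using assms
proof (induction arbitrary: h)
  case (cancel x u b v)
  then show ?case by (simp only: weight_append append_Cons append_Nil weight_cancel)
next
  case (rel l m u v)
  then obtain x y where xy: "x \<in> X" "y \<in> X" and l: "l = [(x, True), (y, True)]"
      and m: "m = [(sol_sigma r x y, True), (sol_tau r y x, True)]"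
    by (auto simp: structure_relations_def)
  show ?case
    unfolding l m weight_append[of h u]
    by (simp only: weight_relation[OF eta_invariant_word_perm[OF rel.prems] xy])
qed simp_all

end

section \<open>Skew braces\<close>

context skew_brace
begin

interpretation A: group "add_monoid B" by (rule additive_group)
interpretation M: group B by (rule multiplicative_group)

abbreviation multiple :: "nat \<Rightarrow> 'a \<Rightarrow> 'a"
  where "multiple n b \<equiv> b [^]\<^bsub>add_monoid B\<^esub> n"

lemma add_assoc:
  "a \<in> carrier B \<Longrightarrow> b \<in> carrier B \<Longrightarrow> c \<in> carrier B \<Longrightarrow> a \<oplus> b \<oplus> c = a \<oplus> (b \<oplus> c)"
  using A.m_assoc by simp

lemma neg_closed: "a \<in> carrier B \<Longrightarrow> \<ominus> a \<in> carrier B"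
  using A.inv_closed by (simp add: a_inv_def)

lemma add_closed: "a \<in> carrier B \<Longrightarrow> b \<in> carrier B \<Longrightarrow> a \<oplus> b \<in> carrier B"
  using A.m_closed by simp

lemma zero_closed: "\<zero> \<in> carrier B"
  using A.one_closed by simp

lemma add_zero: "a \<in> carrier B \<Longrightarrow> a \<oplus> \<zero> = a" "a \<in> carrier B \<Longrightarrow> \<zero> \<oplus> a = a"
  using A.r_one A.l_one by simp_all

lemma add_neg: "a \<in> carrier B \<Longrightarrow> a \<oplus> \<ominus> a = \<zero>" "a \<in> carrier B \<Longrightarrow> \<ominus> a \<oplus> a = \<zero>"
  using A.r_inv A.l_inv by (simp_all add: a_inv_def)

lemma add_neg_cancel:
  assumes "a \<in> carrier B" "b \<in> carrier B"
  shows "\<ominus> a \<oplus> (a \<oplus> b) = b" "a \<oplus> (\<ominus> a \<oplus> b) = b"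
  using assms add_assoc[of "\<ominus> a" a b] add_assoc[of a "\<ominus> a" b]
  by (simp_all add: neg_closed add_neg add_zero)

lemmas add_simps = add_assoc neg_closed add_closed zero_closed add_zero add_neg add_neg_cancel

lemma lambda_closed: "a \<in> carrier B \<Longrightarrow> b \<in> carrier B \<Longrightarrow> brace_lambda B a b \<in> carrier B"
  by (simp add: brace_lambda_def add_simps)

lemma mult_eq_add_lambda:
  "a \<in> carrier B \<Longrightarrow> b \<in> carrier B \<Longrightarrow> a \<otimes> b = a \<oplus> brace_lambda B a b"
  by (simp add: brace_lambda_def add_simps)

lemma lambda_add:
  assumes "a \<in> carrier B" "b \<in> carrier B" "c \<in> carrier B"
  shows "brace_lambda B a (b \<oplus> c) = brace_lambda B a b \<oplus> brace_lambda B a c"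
  using assms by (simp add: brace_lambda_def brace_law a_minus_def add_simps)

lemma lambda_zero:
  assumes "a \<in> carrier B" shows "brace_lambda B a \<zero> = \<zero>"
proof -
  have "brace_lambda B a \<zero> = brace_lambda B a \<zero> \<oplus> brace_lambda B a \<zero>"
    using lambda_add[OF assms zero_closed zero_closed] by (simp add: add_simps)
  then show ?thesis
    using add_neg_cancel(1)[of "brace_lambda B a \<zero>" "brace_lambda B a \<zero>"]
    by (simp add: add_simps lambda_closed assms)
qed

lemma zero_eq_one: "\<zero> = \<one>"
proof -
  have "\<zero> = \<one> \<otimes> \<zero>" by (rule M.l_one[OF zero_closed, symmetric])
  also have "\<dots> = \<one>"
    by (simp only: mult_eq_add_lambda lambda_zero add_simps M.one_closed)
  finally show ?thesis .
qed

lemma lambda_one: "b \<in> carrier B \<Longrightarrow> brace_lambda B \<one> b = b"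
  using mult_eq_add_lambda[of \<one> b] add_zero(2)[of "brace_lambda B \<one> b"]
  by (simp add: zero_eq_one lambda_closed)

lemma lambda_mult:
  assumes "a \<in> carrier B" "b \<in> carrier B" "c \<in> carrier B"
  shows "brace_lambda B (a \<otimes> b) c = brace_lambda B a (brace_lambda B b c)"
proof -
  \<comment> \<open>Associativity of the circle operation, expanded by \<open>a \<circ> b = a + \<lambda>\<^sub>a(b)\<close>.\<close>
  have "(a \<otimes> b) \<oplus> brace_lambda B (a \<otimes> b) c = a \<otimes> (b \<otimes> c)"
    using assms by (simp add: mult_eq_add_lambda[symmetric] M.m_assoc)
  also have "\<dots> = a \<oplus> brace_lambda B a (b \<oplus> brace_lambda B b c)"
    using assms by (simp add: mult_eq_add_lambda lambda_closed add_closed)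
  also have "\<dots> = (a \<otimes> b) \<oplus> brace_lambda B a (brace_lambda B b c)"
    using assms by (simp add: lambda_add lambda_closed add_simps mult_eq_add_lambda[of a b])
  finally show ?thesis
    using assms by (metis M.m_closed add_neg_cancel(1) lambda_closed)
qed

lemma multiple_closed: "b \<in> carrier B \<Longrightarrow> multiple n b \<in> carrier B"
  using A.nat_pow_closed by simp

lemma lambda_multiple:
  assumes "a \<in> carrier B" "b \<in> carrier B"
  shows "brace_lambda B a (multiple n b) = multiple n (brace_lambda B a b)"
  using assms by (induction n) (simp_all add: lambda_zero lambda_add multiple_closed)

lemma star_zero_iff:
  assumes "a \<in> carrier B" "b \<in> carrier B"
  shows "brace_star B a b = \<zero> \<longleftrightarrow> brace_lambda B a b = b"
proof -
  have star: "brace_star B a b = brace_lambda B a b \<oplus> \<ominus> b"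
    by (simp add: brace_star_def brace_lambda_def a_minus_def)
  then have "brace_star B a b \<oplus> b = brace_lambda B a b"
    using assms by (simp add: add_simps lambda_closed)
  then show ?thesis using assms star by (auto simp: add_simps)
qed

text \<open>
  If the cosets of \<open>m b\<close> and \<open>n b\<close> coincide for some \<open>m < n\<close>, then, as \<open>\<zero> \<in> H\<close>, the element
  \<open>n b = (n - m) b + m b\<close> lies in \<open>H + m b\<close>, so \<open>(n - m) b\<close> lies in \<open>H\<close>.
\<close>

lemma multiple_in_finite_index:
  assumes fin: "finite (rcosets\<^bsub>add_monoid B\<^esub> H)" and H: "H \<subseteq> carrier B" "\<zero> \<in> H"
    and b: "b \<in> carrier B"
  shows "\<exists>n>0. multiple n b \<in> H"
proof -
  let ?f = "\<lambda>n. H #>\<^bsub>add_monoid B\<^esub> multiple n b"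
  have "range ?f \<subseteq> rcosets\<^bsub>add_monoid B\<^esub> H"
    using b multiple_closed by (auto simp: RCOSETS_def)
  then have "finite (range ?f)" using fin finite_subset by blast
  then have "\<not> inj ?f" using finite_imageD infinite_UNIV_nat by blast
  then obtain m n where mn: "?f m = ?f n" "m < n" unfolding inj_def by (metis linorder_neqE_nat)
  have "multiple n b \<in> ?f n"
    using H(2) b multiple_closed[OF b, of n] by (force simp: r_coset_def add_zero)
  then obtain h where h: "h \<in> H" "multiple n b = h \<oplus> multiple m b"
    unfolding mn(1)[symmetric] by (auto simp: r_coset_def)
  have "multiple n b = multiple (n - m) b \<oplus> multiple m b"
    using A.nat_pow_mult[of b "n - m" m] b mn(2) by simp
  then have "h = multiple (n - m) b"
    using h H(1) A.right_cancel[of "multiple m b" h "multiple (n - m) b"] b multiple_closed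
    by auto
  then show ?thesis using h(1) mn(2) by (intro exI[of _ "n - m"]) simp
qed

lemma property_S_lambda_fixes_multiple:
  assumes "property_S B" and a: "a \<in> carrier B" and b: "b \<in> carrier B"
  shows "\<exists>n>0. brace_lambda B a (multiple n b) = multiple n b"
proof -
  let ?H = "Fix_r B a \<inter> centraliser (add_monoid B) a"
  have "\<zero> \<in> ?H"
    using a by (simp add: Fix_r_def centraliser_def star_zero_iff lambda_zero add_simps)
  moreover have "?H \<subseteq> carrier B" by (auto simp: Fix_r_def)
  ultimately obtain n where "n > 0" "multiple n b \<in> ?H"
    using multiple_in_finite_index[of ?H b] assms by (auto simp: property_S_def finite_index_def)
  then show ?thesis using star_zero_iff[OF a multiple_closed[OF b]] by (auto simp: Fix_r_def)
qed

end

section \<open>The structure skew brace\<close>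

locale structure_skew_brace = nondegenerate_solution X r + skew_brace G
  for X :: "'a set" and r :: "'a \<times> 'a \<Rightarrow> 'a \<times> 'a" and G :: "('a \<times> bool) list set ring" +
  assumes truncate: "monoid.truncate G = structure_group X r"
    and brace_r_iota: "\<And>x y. x \<in> X \<Longrightarrow> y \<in> X \<Longrightarrow>
      brace_r G (structure_iota X r x, structure_iota X r y) =
      map_prod (structure_iota X r) (structure_iota X r) (r (x, y))"
begin

abbreviation word_class :: "('a \<times> bool) list \<Rightarrow> ('a \<times> bool) list set"
  where "word_class w \<equiv> pres_class X (structure_relations X r) w"

abbreviation iota :: "'a \<Rightarrow> ('a \<times> bool) list set"
  where "iota x \<equiv> structure_iota X r x"

lemma G_eqs:
  "carrier G = word_class ` words X" "\<one>\<^bsub>G\<^esub> = word_class []"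
  "mult G = mult (presented_group X (structure_relations X r))"
  using truncate unfolding monoid.truncate_def structure_group_def presented_group_def by simp_all

lemma word_class_closed: "w \<in> words X \<Longrightarrow> word_class w \<in> carrier G"
  by (simp add: G_eqs(1))

lemma word_class_append:
  "u \<in> words X \<Longrightarrow> v \<in> words X \<Longrightarrow> word_class (u @ v) = word_class u \<otimes>\<^bsub>G\<^esub> word_class v"
  by (simp add: G_eqs(3) presented_group_mult)

lemma letter_word: "x \<in> X \<Longrightarrow> [(x, b)] \<in> words X"
  by (simp add: words_def)

lemma iota_closed: "x \<in> X \<Longrightarrow> iota x \<in> carrier G"
  by (simp add: structure_iota_def word_class_closed letter_word)

lemma lambda_iota:
  assumes "x \<in> X" "y \<in> X"
  shows "brace_lambda G (iota x) (iota y) = iota (sol_sigma r x y)"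
  using brace_r_iota[OF assms] by (simp add: brace_r_def r_eq)

lemma lambda_positive_word:
  assumes "set w \<subseteq> X \<times> {True}" "z \<in> X"
  shows "brace_lambda G (word_class w) (iota z) = iota (word_perm X r w z)"
  using assms(1)
proof (induction w)
  case Nil
  then show ?case using assms(2) lambda_one iota_closed G_eqs(2) by simp
next
  case (Cons a w)
  then obtain x where a: "a = (x, True)" and x: "x \<in> X" by auto
  have w: "w \<in> words X" using Cons.prems by (auto simp: words_def)
  have z: "word_perm X r w z \<in> X" using assms(2) by (simp add: word_perm_in_iff)
  have "word_class (a # w) = iota x \<otimes>\<^bsub>G\<^esub> word_class w"
    using word_class_append[OF letter_word[OF x] w] a by (simp add: structure_iota_def)
  then show ?case
    using Cons x z w a assms(2)
    by (simp add: lambda_mult iota_closed word_class_closed lambda_iota letter_perm_def sigma_perm_def)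
qed

text \<open>
  If \<open>n \<iota>(y)\<close> is the class of \<open>w\<close>, then \<open>(n + 1) \<iota>(y) = w + \<iota>(y) = w \<circ> \<lambda>\<^sub>w\<^sup>-\<^sup>1(\<iota>(y))\<close>, so the next
  letter is \<open>z = w\<^sup>-\<^sup>1\<cdot>y\<close>.  Its contribution to the weight is \<open>h(w\<cdot>z) = h(y)\<close>.
\<close>

lemma multiple_iota_word:
  assumes y: "y \<in> X"
  shows "\<exists>w. set w \<subseteq> X \<times> {True} \<and> word_class w = multiple n (iota y) \<and>
    (\<forall>h. weight X r h w = int n * h y)"
proof (induction n)
  case 0
  show ?case using zero_eq_one G_eqs(2) by (intro exI[of _ "[]"]) simp
next
  case (Suc n)
  then obtain w where w: "set w \<subseteq> X \<times> {True}" "word_class w = multiple n (iota y)"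
    and wt: "\<And>h. weight X r h w = int n * h y" by blast
  define z where "z = inv_into UNIV (word_perm X r w) y"
  have z: "word_perm X r w z = y"
    using word_perm_bij[of w] by (simp add: z_def bij_is_surj surj_f_inv_f)
  then have zX: "z \<in> X" using y word_perm_in_iff[of w z] by simp
  have wX: "w \<in> words X" using w(1) by (auto simp: words_def)
  have "word_class (w @ [(z, True)]) = word_class w \<otimes>\<^bsub>G\<^esub> iota z"
    using word_class_append[OF wX letter_word[OF zX]] by (simp add: structure_iota_def)
  also have "\<dots> = multiple n (iota y) \<oplus>\<^bsub>G\<^esub> iota y"
    using mult_eq_add_lambda[OF word_class_closed[OF wX] iota_closed[OF zX]]
      lambda_positive_word[OF w(1) zX] z w(2) by simp
  finally have "word_class (w @ [(z, True)]) = multiple (Suc n) (iota y)" by simp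
  moreover have "weight X r h (w @ [(z, True)]) = int (Suc n) * h y" for h
    by (simp add: weight_append wt z algebra_simps)
  ultimately show ?case using w(1) zX by (intro exI[of _ "w @ [(z, True)]"]) simp
qed

text \<open>
  The map \<open>\<iota>\<close> need not be injective, and \<open>(G,+)\<close> need not be torsion-free, but the \<open>\<eta>\<close>-orbit of \<open>y\<close>
  can be recovered from any positive multiple of \<open>\<iota>(y)\<close>.
\<close>

lemma multiple_iota_eq_imp:
  assumes "y \<in> X" "z \<in> X" and eq: "multiple n (iota y) = multiple n (iota z)" and "n > 0"
    and h: "eta_invariant X r h"
  shows "h y = h z"
proof -
  obtain u where u: "set u \<subseteq> X \<times> {True}" "word_class u = multiple n (iota y)"
      "weight X r h u = int n * h y"
    using multiple_iota_word[OF assms(1), of n] by blast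
  obtain v where v: "set v \<subseteq> X \<times> {True}" "word_class v = multiple n (iota z)"
      "weight X r h v = int n * h z"
    using multiple_iota_word[OF assms(2), of n] by blast
  have "v \<in> words X" using v(1) by (auto simp: words_def)
  then have "pres_eq X (structure_relations X r) u v"
    using u(2) v(2) eq by (simp add: pres_class_eq_iff[symmetric])
  then have "weight X r h u = weight X r h v" using h by (rule weight_pres_eq)
  then show ?thesis using u(3) v(3) \<open>n > 0\<close> by simp
qed

lemma eta_invariant_sigma:
  assumes S: "property_S G" and h: "eta_invariant X r h" and x: "x \<in> X" and y: "y \<in> X"
  shows "h (sol_sigma r x y) = h y"
proof -
  obtain n where n: "n > 0"
      and fixed: "brace_lambda G (iota x) (multiple n (iota y)) = multiple n (iota y)"
    using property_S_lambda_fixes_multiple[OF S iota_closed[OF x] iota_closed[OF y]] by blast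
  have "multiple n (iota (sol_sigma r x y)) = multiple n (iota y)"
    using fixed lambda_multiple[OF iota_closed[OF x] iota_closed[OF y]] lambda_iota[OF x y] by simp
  then show ?thesis using multiple_iota_eq_imp[OF sigma_closed[OF x y] y _ n h] by blast
qed

lemma derived_decomposable_imp_decomposable:
  assumes "finite X" "property_S G" "decomposable X (derived_solution X r)"
  shows "decomposable X r"
proof -
  obtain X1 X2 where X: "X1 \<noteq> {}" "X2 \<noteq> {}" "X1 \<inter> X2 = {}" "X1 \<union> X2 = X"
      and d: "derived_solution X r ` (X1 \<times> X1) \<subseteq> X1 \<times> X1"
        "derived_solution X r ` (X2 \<times> X2) \<subseteq> X2 \<times> X2"
    using assms(3) unfolding decomposable_def by (elim exE conjE) (rule that)
  define h :: "'a \<Rightarrow> int" where "h = (\<lambda>x. if x \<in> X1 then 1 else 0)"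
  have h: "eta_invariant X r h"
    unfolding h_def by (rule eta_invariant_derived_part[OF assms(1) X(3,4) d])
  have mem: "u \<in> X1 \<longleftrightarrow> v \<in> X1" if "h u = h v" for u v
    using that by (auto simp: h_def split: if_splits)
  show ?thesis
  proof (rule decomposable_if_sigma_invariant[OF X])
    fix x y assume xy: "x \<in> X" "y \<in> X"
    show "sol_eta X r y x \<in> X1 \<longleftrightarrow> x \<in> X1" using h xy by (intro mem) (simp add: eta_invariant_def)
    show "sol_sigma r x y \<in> X1 \<longleftrightarrow> y \<in> X1"
      using eta_invariant_sigma[OF assms(2) h xy] by (rule mem)
  qed
qed

end

theorem theorem4p4:
  fixes X :: "'a set" and r :: "'a \<times> 'a \<Rightarrow> 'a \<times> 'a" and G :: "('a \<times> bool) list set ring"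
  assumes "nondegenerate_solution X r"
    and "finite X"
    and "is_structure_skew_brace X r G"
    and "property_S G"
  shows "indecomposable X r \<longleftrightarrow> derived_indecomposable X r"
proof -
  interpret structure_skew_brace X r G
    using assms(1,3)
    by (simp add: structure_skew_brace_def structure_skew_brace_axioms_def is_structure_skew_brace_def)
  show ?thesis
    unfolding indecomposable_def derived_indecomposable_def
    using decomposable_imp_derived_decomposable[OF assms(2)]
      derived_decomposable_imp_decomposable[OF assms(2,4)] by blast
qed

end
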